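(* Let $X=X_T$ be the binary tree space, let $C:=\overline{\mathrm{conv}}(B_X^+\cup B_X^-)$, and let $x\in S_X^+$. If $x$ is an SCD point of $C$, then $x$ is an SCD point of $B_X^+$. In particular, $C$ is not an SCD set.
   Context: Binary tree space: $T=\{\emptyset\}\cup\bigcup_{n\in\mathbb{N}}\{0,1\}^n$ is the infinite binary tree of finite $0$-$1$ sequences, ordered by $s\preceq t$ iff $s$ is an initial segment of $t$. A chain is a non-empty (totally, hence well) ordered subset of $T$; $\mathcal{A}$ is the collection of all chains. $X=X_T$ is the real Banach space obtained by completing the space $c_{00}(T)$ of finitely supported real functions on $T$ for the norm $\|x\|=\sup_{A\in\mathcal{A}}\sum_{t\in A}|x(t)|$. The family $(e_t)_{t\in T}$ of unit vectors is a 1-unconditional basis of $X$, and elements of $X$ are identified with their coordinate functions $x=(x(t))_{t\in T}$. $B_X$, $S_X$ are the closed unit ball and unit sphere. For $A\subseteq X$, $A^+=\{x\in A\colon x(t)\geq0\ \forall t\}$ and $A^-=\{x\in A\colon x(t)\leq 0\ \forall t\}$. Let $A$ be a bounded non-empty subset of $X$. A slice of $A$ is a set $\{x\in A\colon f(x)>\sup f(A)-\delta\}$ with $f\in X^*$, $\delta>0$. $A$ is an SCD set if there is a countable collection $\{S_n\}$ of slices of $A$ such that $A\subseteq\overline{\mathrm{conv}}\{x_n\}$ for every $(x_n)\in\prod_nS_n$. For $A$ bounded and convex, $a\in A$ is an SCD point of $A$ if there is a countable collection $\{S_n\}_{n\in\mathbb{N}}$ of slices of $A$ such that $a\in\overline{\mathrm{conv}}\{x_n\colon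 n\in\mathbb{N}\}$ for every $(x_n)\in\prod_{n\in\mathbb{N}}S_n$. *)

theory Defs
  imports "HOL-Analysis.Analysis" "HOL-Library.Sublist"
begin

section \<open>The binary tree space\<close>

text \<open>
  The tree \<open>T\<close> of all finite 0-1 sequences is the type \<^typ>\<open>bool list\<close>, with \<^term>\<open>[]\<close> as root and
  ordered by \<^const>\<open>prefix\<close>.
\<close>

definition tree_chains :: "bool list set set" where
  "tree_chains = {A. A \<noteq> {} \<and> Complete_Partial_Order.chain prefix A}"

text \<open>
  The norm is first given as an extended value on arbitrary functions on the tree. The completion of
  the finitely supported functions is then realised on coordinate functions, as the closure of the
  finitely supported functions for this norm. The results \<open>norm_tree_space_eq\<close>,
  \<open>dense_finite_support\<close>, \<open>ex_finite_support\<close> and the instance of \<^class>\<open>banach\<close> below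
  confirm that this is the completion.
\<close>

definition tree_norm :: "(bool list \<Rightarrow> real) \<Rightarrow> ennreal" where
  "tree_norm x = (SUP A\<in>tree_chains. \<Sum>\<^sub>\<infinity>t\<in>A. ennreal \<bar>x t\<bar>)"

lemma tree_chains_subset: "A \<in> tree_chains \<Longrightarrow> F \<subseteq> A \<Longrightarrow> F \<noteq> {} \<Longrightarrow> F \<in> tree_chains"
  unfolding tree_chains_def Complete_Partial_Order.chain_def by blast

lemma tree_chains_singleton: "{t} \<in> tree_chains"
  unfolding tree_chains_def Complete_Partial_Order.chain_def by simp

lemma tree_norm_le_iff:
  "tree_norm x \<le> c \<longleftrightarrow> (\<forall>F\<in>tree_chains. finite F \<longrightarrow> ennreal (\<Sum>t\<in>F. \<bar>x t\<bar>) \<le> c)"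
proof -
  have eq: "(\<Sum>\<^sub>\<infinity>t\<in>A. ennreal \<bar>x t\<bar>) =
      (SUP F\<in>{F. finite F \<and> F \<subseteq> A}. ennreal (\<Sum>t\<in>F. \<bar>x t\<bar>))" for A
    by (subst nonneg_infsum_complete) (simp_all add: sum_ennreal)
  show ?thesis
    unfolding tree_norm_def eq SUP_le_iff
  proof safe
    fix F assume "\<forall>A\<in>tree_chains. \<forall>F\<in>{F. finite F \<and> F \<subseteq> A}. ennreal (\<Sum>t\<in>F. \<bar>x t\<bar>) \<le> c"
      "F \<in> tree_chains" "finite F"
    then show "ennreal (\<Sum>t\<in>F. \<bar>x t\<bar>) \<le> c" by blast
  next
    fix A F assume *: "\<forall>F\<in>tree_chains. finite F \<longrightarrow> ennreal (\<Sum>t\<in>F. \<bar>x t\<bar>) \<le> c"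
      "A \<in> tree_chains" "finite F" "F \<subseteq> A"
    show "ennreal (\<Sum>t\<in>F. \<bar>x t\<bar>) \<le> c"
    proof (cases "F = {}")
      case False
      then show ?thesis using * tree_chains_subset by blast
    qed simp
  qed
qed

lemma sum_le_tree_norm:
  "F \<in> tree_chains \<Longrightarrow> finite F \<Longrightarrow> ennreal (\<Sum>t\<in>F. \<bar>x t\<bar>) \<le> tree_norm x"
  using tree_norm_le_iff by blast

lemma tree_norm_zero: "tree_norm (\<lambda>t. 0) = 0"
proof -
  have "tree_norm (\<lambda>t. 0) \<le> 0"
    unfolding tree_norm_le_iff by simp
  then show ?thesis by simp
qed

lemma tree_norm_triangle: "tree_norm (\<lambda>t. x t + y t) \<le> tree_norm x + tree_norm y"
  unfolding tree_norm_le_iff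
proof (intro ballI impI)
  fix F assume F: "F \<in> tree_chains" "finite F"
  have "ennreal (\<Sum>t\<in>F. \<bar>x t + y t\<bar>) \<le> ennreal ((\<Sum>t\<in>F. \<bar>x t\<bar>) + (\<Sum>t\<in>F. \<bar>y t\<bar>))"
    unfolding sum.distrib[symmetric] by (intro ennreal_leI sum_mono) linarith
  also have "\<dots> = ennreal (\<Sum>t\<in>F. \<bar>x t\<bar>) + ennreal (\<Sum>t\<in>F. \<bar>y t\<bar>)"
    by (intro ennreal_plus sum_nonneg) auto
  also have "\<dots> \<le> tree_norm x + tree_norm y"
    by (intro add_mono sum_le_tree_norm F)
  finally show "ennreal (\<Sum>t\<in>F. \<bar>x t + y t\<bar>) \<le> tree_norm x + tree_norm y" .
qed

lemma tree_norm_scale: "tree_norm (\<lambda>t. c * x t) \<le> ennreal \<bar>c\<bar> * tree_norm x"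
  unfolding tree_norm_le_iff
proof (intro ballI impI)
  fix F assume F: "F \<in> tree_chains" "finite F"
  have "ennreal (\<Sum>t\<in>F. \<bar>c * x t\<bar>) = ennreal \<bar>c\<bar> * ennreal (\<Sum>t\<in>F. \<bar>x t\<bar>)"
    by (simp add: abs_mult sum_distrib_left[symmetric] ennreal_mult sum_nonneg)
  also have "\<dots> \<le> ennreal \<bar>c\<bar> * tree_norm x"
    by (intro mult_left_mono sum_le_tree_norm F) simp
  finally show "ennreal (\<Sum>t\<in>F. \<bar>c * x t\<bar>) \<le> ennreal \<bar>c\<bar> * tree_norm x" .
qed

lemma tree_norm_finite_support:
  assumes "finite {t. x t \<noteq> 0}"
  shows "tree_norm x < \<infinity>"
proof -
  have "tree_norm x \<le> ennreal (\<Sum>t | x t \<noteq> 0. \<bar>x t\<bar>)"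
    unfolding tree_norm_le_iff
  proof (intro ballI impI ennreal_leI)
    fix F :: "bool list set" assume F: "finite F"
    have "(\<Sum>t\<in>F. \<bar>x t\<bar>) = (\<Sum>t\<in>F \<inter> {t. x t \<noteq> 0}. \<bar>x t\<bar>)"
      using F by (intro sum.mono_neutral_right) auto
    also have "\<dots> \<le> (\<Sum>t | x t \<noteq> 0. \<bar>x t\<bar>)"
      using assms by (intro sum_mono2) auto
    finally show "(\<Sum>t\<in>F. \<bar>x t\<bar>) \<le> (\<Sum>t | x t \<noteq> 0. \<bar>x t\<bar>)" .
  qed
  then show ?thesis by (simp add: order_le_less_trans)
qed

definition tree_carrier :: "(bool list \<Rightarrow> real) set" where
  "tree_carrier =
    {x. \<forall>\<epsilon>>0. \<exists>y. finite {t. y t \<noteq> 0} \<and> tree_norm (\<lambda>t. x t - y t) < ennreal \<epsilon>}"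

lemma finite_support_in_carrier: "finite {t. x t \<noteq> 0} \<Longrightarrow> x \<in> tree_carrier"
  unfolding tree_carrier_def by (auto intro!: exI[of _ x] simp: tree_norm_zero)

lemma carrier_add:
  assumes "x \<in> tree_carrier" "y \<in> tree_carrier"
  shows "(\<lambda>t. x t + y t) \<in> tree_carrier"
  unfolding tree_carrier_def
proof (intro CollectI allI impI)
  fix \<epsilon> :: real assume \<epsilon>: "\<epsilon> > 0"
  then have "\<epsilon> / 2 > 0" by simp
  then obtain u v where u: "finite {t. u t \<noteq> 0}" "tree_norm (\<lambda>t. x t - u t) < ennreal (\<epsilon>/2)"
    and v: "finite {t. v t \<noteq> 0}" "tree_norm (\<lambda>t. y t - v t) < ennreal (\<epsilon>/2)"
    using assms unfolding tree_carrier_def by blast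
  have fin: "finite {t. u t + v t \<noteq> 0}"
    by (rule finite_subset[of _ "{t. u t \<noteq> 0} \<union> {t. v t \<noteq> 0}"]) (use u v in auto)
  have "tree_norm (\<lambda>t. (x t + y t) - (u t + v t)) =
      tree_norm (\<lambda>t. (x t - u t) + (y t - v t))"
    by (simp add: algebra_simps)
  also have "\<dots> \<le> tree_norm (\<lambda>t. x t - u t) + tree_norm (\<lambda>t. y t - v t)"
    by (rule tree_norm_triangle)
  also have "\<dots> < ennreal (\<epsilon>/2) + ennreal (\<epsilon>/2)"
    using u(2) v(2) by (rule add_strict_mono)
  also have "\<dots> = ennreal \<epsilon>"
    using \<epsilon> by (simp flip: ennreal_plus)
  finally show "\<exists>w. finite {t. w t \<noteq> 0} \<and> tree_norm (\<lambda>t. (x t + y t) - w t) < ennreal \<epsilon>"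
    using fin by (intro exI[of _ "\<lambda>t. u t + v t"] conjI)
qed

lemma carrier_scale:
  assumes "x \<in> tree_carrier"
  shows "(\<lambda>t. c * x t) \<in> tree_carrier"
  unfolding tree_carrier_def
proof (intro CollectI allI impI)
  fix \<epsilon> :: real assume \<epsilon>: "\<epsilon> > 0"
  then have "\<epsilon> / (\<bar>c\<bar> + 1) > 0" by simp
  then obtain u where u: "finite {t. u t \<noteq> 0}"
      "tree_norm (\<lambda>t. x t - u t) < ennreal (\<epsilon> / (\<bar>c\<bar> + 1))"
    using assms unfolding tree_carrier_def by blast
  have "tree_norm (\<lambda>t. c * x t - c * u t) = tree_norm (\<lambda>t. c * (x t - u t))"
    by (simp add: algebra_simps)
  also have "\<dots> \<le> ennreal \<bar>c\<bar> * tree_norm (\<lambda>t. x t - u t)"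
    by (rule tree_norm_scale)
  also have "\<dots> \<le> ennreal \<bar>c\<bar> * ennreal (\<epsilon> / (\<bar>c\<bar> + 1))"
    using u(2) by (intro mult_left_mono) auto
  also have "\<dots> = ennreal (\<bar>c\<bar> * (\<epsilon> / (\<bar>c\<bar> + 1)))"
    using \<epsilon> by (intro ennreal_mult[symmetric]) auto
  also have "\<dots> < ennreal \<epsilon>"
    using \<epsilon> by (intro ennreal_lessI) (auto simp: field_simps)
  finally have "tree_norm (\<lambda>t. c * x t - c * u t) < ennreal \<epsilon>" .
  moreover have "finite {t. c * u t \<noteq> 0}"
    by (rule finite_subset[OF _ u(1)]) auto
  ultimately show "\<exists>w. finite {t. w t \<noteq> 0} \<and> tree_norm (\<lambda>t. c * x t - w t) < ennreal \<epsilon>"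
    by (intro exI[of _ "\<lambda>t. c * u t"]) simp
qed

lemma tree_norm_carrier_finite:
  assumes "x \<in> tree_carrier"
  shows "tree_norm x < \<infinity>"
proof -
  obtain u where u: "finite {t. u t \<noteq> 0}" "tree_norm (\<lambda>t. x t - u t) < ennreal 1"
    using assms unfolding tree_carrier_def by (blast intro: zero_less_one)
  have "tree_norm x = tree_norm (\<lambda>t. (x t - u t) + u t)" by simp
  also have "\<dots> \<le> tree_norm (\<lambda>t. x t - u t) + tree_norm u" by (rule tree_norm_triangle)
  also have "\<dots> < \<infinity>"
    using u(2) tree_norm_finite_support[OF u(1)]
    by (metis ennreal_add_less_top infinity_ennreal_def ennreal_less_top less_trans)
  finally show ?thesis .
qed

typedef tree_space = tree_carrier
  morphisms coord Abs_tree_space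
  by (rule exI[of _ "\<lambda>t. 0"], rule finite_support_in_carrier) simp

setup_lifting type_definition_tree_space

instantiation tree_space :: real_vector
begin

lift_definition zero_tree_space :: tree_space is "\<lambda>t. 0"
  by (rule finite_support_in_carrier) simp

lift_definition plus_tree_space :: "tree_space \<Rightarrow> tree_space \<Rightarrow> tree_space"
  is "\<lambda>x y t. x t + y t"
  by (rule carrier_add)

lift_definition uminus_tree_space :: "tree_space \<Rightarrow> tree_space" is "\<lambda>x t. - x t"
  using carrier_scale[of _ "-1"] by simp

lift_definition minus_tree_space :: "tree_space \<Rightarrow> tree_space \<Rightarrow> tree_space"
  is "\<lambda>x y t. x t - y t"
  using carrier_add carrier_scale[of _ "-1"] by fastforce

lift_definition scaleR_tree_space :: "real \<Rightarrow> tree_space \<Rightarrow> tree_space" is "\<lambda>c x t. c * x t"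
  by (rule carrier_scale)

instance
proof
  fix x y z :: tree_space and a b :: real
  show "x + y + z = x + (y + z)" by transfer (simp add: algebra_simps)
  show "x + y = y + x" by transfer (simp add: algebra_simps)
  show "0 + x = x" by transfer simp
  show "- x + x = 0" by transfer simp
  show "x - y = x + - y" by transfer simp
  show "a *\<^sub>R (x + y) = a *\<^sub>R x + a *\<^sub>R y" by transfer (simp add: algebra_simps)
  show "(a + b) *\<^sub>R x = a *\<^sub>R x + b *\<^sub>R x" by transfer (simp add: algebra_simps)
  show "a *\<^sub>R b *\<^sub>R x = (a * b) *\<^sub>R x" by transfer (simp add: algebra_simps)
  show "1 *\<^sub>R x = x" by transfer simp
qed

end

instantiation tree_space :: real_normed_vector
begin

definition norm_tree_space :: "tree_space \<Rightarrow> real" where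
  "norm_tree_space x = enn2real (tree_norm (coord x))"

definition dist_tree_space :: "tree_space \<Rightarrow> tree_space \<Rightarrow> real" where
  "dist_tree_space x y = norm (x - y)"

definition sgn_tree_space :: "tree_space \<Rightarrow> tree_space" where
  "sgn_tree_space x = x /\<^sub>R norm x"

definition uniformity_tree_space :: "(tree_space \<times> tree_space) filter" where
  "uniformity_tree_space = (INF e\<in>{0<..}. principal {(x, y). dist x y < e})"

definition open_tree_space :: "tree_space set \<Rightarrow> bool" where
  "open_tree_space U \<longleftrightarrow> (\<forall>x\<in>U. \<forall>\<^sub>F (x', y) in uniformity. x' = x \<longrightarrow> y \<in> U)"

lemma ennreal_norm: "ennreal (norm x) = tree_norm (coord x)" for x :: tree_space
  unfolding norm_tree_space_def
  using tree_norm_carrier_finite[OF coord[of x]] by (simp add: less_top)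

lemma norm_le_iff:
  fixes x :: tree_space
  assumes "c \<ge> 0"
  shows "norm x \<le> c \<longleftrightarrow> (\<forall>F\<in>tree_chains. finite F \<longrightarrow> (\<Sum>t\<in>F. \<bar>coord x t\<bar>) \<le> c)"
proof -
  have "norm x \<le> c \<longleftrightarrow> tree_norm (coord x) \<le> ennreal c"
    using assms by (simp flip: ennreal_norm)
  also have "\<dots> \<longleftrightarrow> (\<forall>F\<in>tree_chains. finite F \<longrightarrow> (\<Sum>t\<in>F. \<bar>coord x t\<bar>) \<le> c)"
    unfolding tree_norm_le_iff using assms by simp
  finally show ?thesis .
qed

lemma norm_nonneg: "norm x \<ge> 0" for x :: tree_space
  unfolding norm_tree_space_def by simp

lemma sum_le_norm:
  fixes x :: tree_space
  shows "F \<in> tree_chains \<Longrightarrow> finite F \<Longrightarrow> (\<Sum>t\<in>F. \<bar>coord x t\<bar>) \<le> norm x"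
  using norm_le_iff[OF norm_nonneg, of x x] by blast

lemma abs_coord_le_norm: "\<bar>coord x t\<bar> \<le> norm x" for x :: tree_space
  using sum_le_norm[OF tree_chains_singleton, of t x] by simp

instance
proof
  fix x y :: tree_space and a :: real
  show "dist x y = norm (x - y)" by (rule dist_tree_space_def)
  show "sgn x = x /\<^sub>R norm x" by (rule sgn_tree_space_def)
  show "uniformity = (INF e\<in>{0<..}. principal {(x, y :: tree_space). dist x y < e})"
    by (rule uniformity_tree_space_def)
  show "open U \<longleftrightarrow> (\<forall>x\<in>U. \<forall>\<^sub>F (x', y) in uniformity. x' = x \<longrightarrow> y \<in> U)"
    for U :: "tree_space set"
    by (rule open_tree_space_def)
  show "norm x = 0 \<longleftrightarrow> x = 0"
  proof
    assume "norm x = 0"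
    then have "coord x t = 0" for t
      using abs_coord_le_norm[of x t] by simp
    then show "x = 0"
      by (metis coord_inject zero_tree_space.rep_eq ext)
  qed (simp add: norm_tree_space_def zero_tree_space.rep_eq tree_norm_zero)
  have "ennreal (norm (x + y)) \<le> ennreal (norm x + norm y)"
    using tree_norm_triangle[of "coord x" "coord y"]
    by (simp add: ennreal_norm ennreal_plus norm_nonneg plus_tree_space.rep_eq)
  then show "norm (x + y) \<le> norm x + norm y"
    using norm_nonneg[of x] norm_nonneg[of y]
    by (subst (asm) ennreal_le_iff) auto
  have le: "norm (c *\<^sub>R u) \<le> \<bar>c\<bar> * norm u" for c and u :: tree_space
  proof -
    have "ennreal (norm (c *\<^sub>R u)) \<le> ennreal (\<bar>c\<bar> * norm u)"
      using tree_norm_scale[of c "coord u"]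
      by (simp add: ennreal_norm ennreal_mult norm_nonneg scaleR_tree_space.rep_eq)
    then show ?thesis
      using norm_nonneg[of u] by simp
  qed
  show "norm (a *\<^sub>R x) = \<bar>a\<bar> * norm x"
  proof (cases "a = 0")
    case True
    then show ?thesis using le[of a x] norm_nonneg[of "a *\<^sub>R x"] by simp
  next
    case False
    have "inverse a *\<^sub>R a *\<^sub>R x = x"
      using False by transfer simp
    then have "norm x \<le> \<bar>inverse a\<bar> * norm (a *\<^sub>R x)"
      using le[of "inverse a" "a *\<^sub>R x"] by simp
    then have "\<bar>a\<bar> * norm x \<le> norm (a *\<^sub>R x)"
      using False by (simp add: field_simps)
    then show ?thesis using le[of a x] by simp
  qed
qed

end

lemma coord_linear [simp]:
  "coord 0 t = 0" "coord (x + y) t = coord x t + coord y t"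
  "coord (x - y) t = coord x t - coord y t" "coord (- x) t = - coord x t"
  "coord (c *\<^sub>R x) t = c * coord x t"
  by (simp_all add: zero_tree_space.rep_eq plus_tree_space.rep_eq minus_tree_space.rep_eq
      uminus_tree_space.rep_eq scaleR_tree_space.rep_eq)

instance tree_space :: banach
proof
  fix X :: "nat \<Rightarrow> tree_space" assume X: "Cauchy X"
  have "Cauchy (\<lambda>n. coord (X n) t)" for t
    unfolding Cauchy_def
  proof (intro allI impI)
    fix e :: real assume "e > 0"
    then obtain M where M: "\<forall>m\<ge>M. \<forall>n\<ge>M. dist (X m) (X n) < e"
      using X unfolding Cauchy_def by blast
    have "dist (coord (X m) t) (coord (X n) t) \<le> dist (X m) (X n)" for m n
      using abs_coord_le_norm[of "X m - X n" t] by (simp add: dist_norm)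
    then show "\<exists>M. \<forall>m\<ge>M. \<forall>n\<ge>M. dist (coord (X m) t) (coord (X n) t) < e"
      using M by (meson le_less_trans)
  qed
  then have "\<exists>l. (\<lambda>n. coord (X n) t) \<longlonglongrightarrow> l" for t
    by (simp add: Cauchy_convergent_iff convergent_def)
  then obtain l where l: "\<And>t. (\<lambda>n. coord (X n) t) \<longlonglongrightarrow> l t"
    by metis
  have close: "\<exists>M. \<forall>n\<ge>M. tree_norm (\<lambda>t. l t - coord (X n) t) \<le> ennreal e" if e: "e > 0" for e
  proof -
    obtain M where M: "\<forall>m\<ge>M. \<forall>n\<ge>M. dist (X m) (X n) < e"
      using X e unfolding Cauchy_def by blast
    have "tree_norm (\<lambda>t. l t - coord (X n) t) \<le> ennreal e" if n: "n \<ge> M" for n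
      unfolding tree_norm_le_iff
    proof (intro ballI impI ennreal_leI)
      fix F assume F: "F \<in> tree_chains" "finite F"
      have "(\<lambda>m. \<Sum>t\<in>F. \<bar>coord (X m) t - coord (X n) t\<bar>) \<longlonglongrightarrow> (\<Sum>t\<in>F. \<bar>l t - coord (X n) t\<bar>)"
        by (intro tendsto_intros l)
      moreover have "(\<Sum>t\<in>F. \<bar>coord (X m) t - coord (X n) t\<bar>) \<le> e" if "m \<ge> M" for m
      proof -
        have "norm (X m - X n) \<le> e"
          using M n that by (auto simp: dist_norm intro: less_imp_le)
        then show ?thesis
          using sum_le_norm[OF F, of "X m - X n"] by simp
      qed
      ultimately show "(\<Sum>t\<in>F. \<bar>l t - coord (X n) t\<bar>) \<le> e"
        by (intro Lim_bounded[where M = M]) auto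
    qed
    then show ?thesis by blast
  qed
  have "l \<in> tree_carrier"
    unfolding tree_carrier_def
  proof (intro CollectI allI impI)
    fix \<epsilon> :: real assume \<epsilon>: "\<epsilon> > 0"
    then obtain n where n: "tree_norm (\<lambda>t. l t - coord (X n) t) \<le> ennreal (\<epsilon>/2)"
      using close[of "\<epsilon>/2"] by auto
    have "\<epsilon> / 2 > 0" using \<epsilon> by simp
    then obtain u where u: "finite {t. u t \<noteq> 0}"
        "tree_norm (\<lambda>t. coord (X n) t - u t) < ennreal (\<epsilon>/2)"
      using coord[of "X n"] unfolding tree_carrier_def by blast
    have "tree_norm (\<lambda>t. l t - u t) =
        tree_norm (\<lambda>t. (l t - coord (X n) t) + (coord (X n) t - u t))"
      by simp
    also have "\<dots> \<le> tree_norm (\<lambda>t. l t - coord (X n) t) + tree_norm (\<lambda>t. coord (X n) t - u t)"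
      by (rule tree_norm_triangle)
    also have "\<dots> < ennreal (\<epsilon>/2) + ennreal (\<epsilon>/2)"
      using n u(2) by (intro ennreal_add_left_cancel_less[THEN iffD2, THEN order_le_less_trans[rotated]]
          add_right_mono) auto
    also have "\<dots> = ennreal \<epsilon>"
      using \<epsilon> by (simp flip: ennreal_plus)
    finally show "\<exists>u. finite {t. u t \<noteq> 0} \<and> tree_norm (\<lambda>t. l t - u t) < ennreal \<epsilon>"
      using u(1) by blast
  qed
  then obtain x where x: "coord x = l"
    by (metis Abs_tree_space_inverse)
  have "X \<longlonglongrightarrow> x"
    unfolding lim_sequentially
  proof (intro allI impI)
    fix r :: real assume r: "r > 0"
    then obtain M where M: "\<And>n. n \<ge> M \<Longrightarrow> tree_norm (\<lambda>t. l t - coord (X n) t) \<le> ennreal (r/2)"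
      using close[of "r/2"] by auto
    have "dist (X n) x < r" if "n \<ge> M" for n
    proof -
      have "ennreal (norm (x - X n)) \<le> ennreal (r/2)"
        using M[OF that] by (simp add: ennreal_norm minus_tree_space.rep_eq x)
      then have "norm (x - X n) \<le> r / 2" using r by simp
      then show ?thesis using r by (simp add: dist_norm norm_minus_commute)
    qed
    then show "\<exists>M. \<forall>n\<ge>M. dist (X n) x < r" by blast
  qed
  then show "convergent X" by (auto simp: convergent_def)
qed

lemma ex_finite_support:
  assumes "finite {t. x t \<noteq> 0}"
  shows "\<exists>!y. coord y = x"
  using finite_support_in_carrier[OF assms] by (metis Abs_tree_space_inverse coord_inject)

lemma dense_finite_support: "closure {x. finite {t. coord x t \<noteq> 0}} = UNIV"
proof -
  have "x \<in> closure {x. finite {t. coord x t \<noteq> 0}}" for x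
    unfolding closure_approachable
  proof (intro allI impI)
    fix e :: real assume e: "e > 0"
    then obtain u where u: "finite {t. u t \<noteq> 0}" "tree_norm (\<lambda>t. coord x t - u t) < ennreal e"
      using coord[of x] unfolding tree_carrier_def by blast
    obtain y where y: "coord y = u" using ex_finite_support[OF u(1)] by blast
    have "ennreal (norm (x - y)) < ennreal e"
      using u(2) by (simp add: ennreal_norm minus_tree_space.rep_eq y)
    then have "dist y x < e"
      using e by (simp add: dist_norm norm_minus_commute ennreal_less_iff)
    then show "\<exists>y\<in>{x. finite {t. coord x t \<noteq> 0}}. dist y x < e"
      using u(1) y by blast
  qed
  then show ?thesis by blast
qed

lemma coord_summable_on_chain:
  assumes "A \<in> tree_chains"
  shows "(\<lambda>t. \<bar>coord x t\<bar>) summable_on A" "(\<Sum>\<^sub>\<infinity>t\<in>A. \<bar>coord x t\<bar>) \<le> norm x"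
proof -
  have le: "(\<Sum>t\<in>F. \<bar>coord x t\<bar>) \<le> norm x" if "finite F" "F \<subseteq> A" for F
    using that assms sum_le_norm[of F x] tree_chains_subset[of A F]
    by (cases "F = {}") auto
  show sm: "(\<lambda>t. \<bar>coord x t\<bar>) summable_on A"
    by (rule nonneg_bdd_above_summable_on) (auto intro!: bdd_aboveI2[where M = "norm x"] le)
  show "(\<Sum>\<^sub>\<infinity>t\<in>A. \<bar>coord x t\<bar>) \<le> norm x"
    by (rule infsum_le_finite_sums[OF sm]) (rule le)
qed

lemma norm_tree_space_eq: "norm x = (SUP A\<in>tree_chains. \<Sum>\<^sub>\<infinity>t\<in>A. \<bar>coord x t\<bar>)"
proof (rule antisym)
  have bdd: "bdd_above ((\<lambda>A. \<Sum>\<^sub>\<infinity>t\<in>A. \<bar>coord x t\<bar>) ` tree_chains)"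
    by (auto intro!: bdd_aboveI2[where M = "norm x"] coord_summable_on_chain)
  have up: "(\<Sum>\<^sub>\<infinity>t\<in>A. \<bar>coord x t\<bar>) \<le> (SUP A\<in>tree_chains. \<Sum>\<^sub>\<infinity>t\<in>A. \<bar>coord x t\<bar>)"
    if "A \<in> tree_chains" for A
    by (rule cSUP_upper[OF that bdd])
  have "0 \<le> (SUP A\<in>tree_chains. \<Sum>\<^sub>\<infinity>t\<in>A. \<bar>coord x t\<bar>)"
    by (rule order_trans[OF _ up[OF tree_chains_singleton]]) (rule infsum_nonneg, simp)
  then show "norm x \<le> (SUP A\<in>tree_chains. \<Sum>\<^sub>\<infinity>t\<in>A. \<bar>coord x t\<bar>)"
    unfolding norm_le_iff[OF \<open>0 \<le> _\<close>] using up by (metis infsum_finite)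
  show "(SUP A\<in>tree_chains. \<Sum>\<^sub>\<infinity>t\<in>A. \<bar>coord x t\<bar>) \<le> norm x"
    using tree_chains_singleton by (intro cSUP_least coord_summable_on_chain) auto
qed

definition pos_part :: "tree_space set \<Rightarrow> tree_space set" where
  "pos_part A = {x \<in> A. \<forall>t. coord x t \<ge> 0}"

definition neg_part :: "tree_space set \<Rightarrow> tree_space set" where
  "neg_part A = {x \<in> A. \<forall>t. coord x t \<le> 0}"


section \<open>Slices, SCD sets and SCD points\<close>

text \<open>
  These notions are meant for bounded non-empty sets (convex ones, for SCD points). Slices of such
  sets are non-empty, so that a countable collection of slices, repeating members if it is finite,
  may be indexed by the natural numbers.
\<close>

definition slice :: "'a::real_normed_vector set \<Rightarrow> ('a \<Rightarrow>\<^sub>L real) \<Rightarrow> real \<Rightarrow> 'a set" where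
  "slice A f \<delta> = {x \<in> A. blinfun_apply f x > Sup (blinfun_apply f ` A) - \<delta>}"

definition is_slice :: "'a::real_normed_vector set \<Rightarrow> 'a set \<Rightarrow> bool" where
  "is_slice A S \<longleftrightarrow> (\<exists>f \<delta>. \<delta> > 0 \<and> S = slice A f \<delta>)"

definition SCD_set :: "'a::real_normed_vector set \<Rightarrow> bool" where
  "SCD_set A \<longleftrightarrow>
    (\<exists>S :: nat \<Rightarrow> 'a set. (\<forall>n. is_slice A (S n)) \<and>
      (\<forall>x :: nat \<Rightarrow> 'a. (\<forall>n. x n \<in> S n) \<longrightarrow> A \<subseteq> closure (convex hull (range x))))"

definition SCD_point :: "'a::real_normed_vector set \<Rightarrow> 'a \<Rightarrow> bool" where
  "SCD_point A a \<longleftrightarrow> a \<in> A \<and>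
    (\<exists>S :: nat \<Rightarrow> 'a set. (\<forall>n. is_slice A (S n)) \<and>
      (\<forall>x :: nat \<Rightarrow> 'a. (\<forall>n. x n \<in> S n) \<longrightarrow> a \<in> closure (convex hull (range x))))"

definition tree_C :: "tree_space set" where
  "tree_C = closure (convex hull (pos_part (cball 0 1) \<union> neg_part (cball 0 1)))"

lemma pos_part_cball: "bounded (pos_part (cball 0 1))" "convex (pos_part (cball 0 1))"
    "pos_part (cball 0 1) \<noteq> {}"
proof -
  show "bounded (pos_part (cball 0 1))"
    by (rule bounded_subset[OF bounded_cball[of 0 1]]) (auto simp: pos_part_def)
  show "convex (pos_part (cball 0 1))"
    unfolding convex_def
  proof (intro ballI allI impI)
    fix x y and u v :: real
    assume *: "x \<in> pos_part (cball 0 1)" "y \<in> pos_part (cball 0 1)" "0 \<le> u" "0 \<le> v" "u + v = 1"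
    then have "u *\<^sub>R x + v *\<^sub>R y \<in> cball 0 1"
      by (intro convexD[OF convex_cball]) (auto simp: pos_part_def)
    then show "u *\<^sub>R x + v *\<^sub>R y \<in> pos_part (cball 0 1)"
      using * by (auto simp: pos_part_def)
  qed
  have "0 \<in> pos_part (cball 0 1)" by (simp add: pos_part_def)
  then show "pos_part (cball 0 1) \<noteq> {}" by blast
qed

lemma tree_C_props: "bounded tree_C" "convex tree_C" "tree_C \<noteq> {}"
proof -
  have "bounded (pos_part (cball 0 1) \<union> neg_part (cball 0 1))"
    by (rule bounded_subset[OF bounded_cball[of 0 1]]) (auto simp: pos_part_def neg_part_def)
  then show "bounded tree_C"
    unfolding tree_C_def by (intro bounded_closure bounded_convex_hull)
  show "convex tree_C"
    unfolding tree_C_def by (intro convex_closure convex_convex_hull)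
  show "tree_C \<noteq> {}"
    unfolding tree_C_def using pos_part_cball(3) by simp
qed

lemma slice_nonempty:
  fixes A :: "'a::real_normed_vector set"
  assumes "bounded A" "A \<noteq> {}" "is_slice A S"
  shows "S \<noteq> {}"
proof -
  obtain f \<delta> where S: "\<delta> > 0" "S = slice A f \<delta>"
    using assms(3) unfolding is_slice_def by blast
  have "bounded (blinfun_apply f ` A)"
    using assms(1) by (rule bounded_linear_image) (rule blinfun.bounded_linear_right)
  then have "bdd_above (blinfun_apply f ` A)" by (rule bounded_imp_bdd_above)
  moreover have "Sup (blinfun_apply f ` A) - \<delta> < Sup (blinfun_apply f ` A)" using S(1) by simp
  ultimately obtain x where "x \<in> A" "Sup (blinfun_apply f ` A) - \<delta> < blinfun_apply f x"
    using assms(2) by (subst (asm) less_cSup_iff) auto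
  then show ?thesis unfolding S(2) slice_def by blast
qed

end

theory Submission
  imports Defs
begin

text \<open>
  Write \<open>B\<^sup>+\<close> and \<open>B\<^sup>-\<close> for the positive and the negative part of the unit ball, and \<open>C\<close> for the closed
  convex hull of their union.

  Passing from \<open>C\<close> to \<open>B\<^sup>+\<close>: the supremum over \<open>C\<close> of a functional is its supremum over \<open>B\<^sup>+\<close> or over
  \<open>B\<^sup>-\<close>. Hence a slice of \<open>C\<close> contains a slice of \<open>B\<^sup>+\<close> or meets \<open>B\<^sup>-\<close> (\<open>slice_tree_C_cases\<close>). Given slices
  of \<open>C\<close> that witness that \<open>x\<close> is an SCD point of \<open>C\<close>, take the slices of \<open>B\<^sup>+\<close> of the first kind, and
  choose a fixed negative point in each slice of the second kind. Then \<open>x\<close> is a limit of convex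
  combinations of positive selections and negative points. Since \<open>x\<close> is positive of norm one, some
  chain carries almost all of its mass, and on that chain the negative points can only lower the sum;
  so their total weight is small, and leaving them out changes little (\<open>closure_hull_drop_neg\<close>).

  The set \<open>C\<close> is not SCD: a slice of \<open>B\<^sup>+\<close> contains a finitely supported element, and
  above any node there are nodes \<open>t\<close>, beyond that support, at which the functional of the slice is
  almost non-negative on the unit vector at \<open>t\<close> (\<open>ex_almost_nonneg_node\<close>). Adding mass at \<open>t\<close> until the
  path from the root to \<open>t\<close> has sum one keeps the element in the slice and in the ball
  (\<open>fill_branch\<close>). For countably many slices the nodes can be chosen along one branch through a
  prescribed node; all points so selected, and hence all their convex combinations, have
  sum one along that branch. So an SCD point of \<open>B\<^sup>+\<close> has path sums close to one above every node
  (\<open>SCD_point_pos_ball_path_sums\<close>). The unit vector at the left child of the root vanishes on all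
  paths through the right child; it is not an SCD point of \<open>B\<^sup>+\<close>, nor, by the first part, of \<open>C\<close>.
\<close>

section \<open>Unit vectors and finitely supported elements\<close>

definition tree_unit :: "bool list \<Rightarrow> tree_space" where
  "tree_unit t = Abs_tree_space (\<lambda>s. of_bool (s = t))"

lemma coord_tree_unit [simp]: "coord (tree_unit t) s = of_bool (s = t)"
proof -
  have "(\<lambda>s. of_bool (s = t) :: real) \<in> tree_carrier"
    by (rule finite_support_in_carrier) (auto intro: finite_subset[of _ "{t}"])
  then show ?thesis
    by (simp add: tree_unit_def Abs_tree_space_inverse)
qed

lemma coord_sum: "coord (\<Sum>i\<in>I. v i) t = (\<Sum>i\<in>I. coord (v i) t)"
  by (induction I rule: infinite_finite_induct) auto

lemma tree_chainsD:
  assumes "F \<in> tree_chains" "s \<in> F" "t \<in> F"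
  shows "prefix s t \<or> prefix t s"
  using assms unfolding tree_chains_def Complete_Partial_Order.chain_def by blast

lemma pos_part_cballI:
  assumes "\<And>t. coord x t \<ge> 0"
    and "\<And>F. F \<in> tree_chains \<Longrightarrow> finite F \<Longrightarrow> (\<Sum>t\<in>F. coord x t) \<le> 1"
  shows "x \<in> pos_part (cball 0 1)"
  using assms norm_le_iff[of 1 x] by (simp add: pos_part_def)

lemma pos_part_cballD:
  assumes "x \<in> pos_part (cball 0 1)"
  shows "coord x t \<ge> 0" "F \<in> tree_chains \<Longrightarrow> finite F \<Longrightarrow> (\<Sum>t\<in>F. coord x t) \<le> 1"
proof -
  show pos: "coord x t \<ge> 0" for t
    using assms by (simp add: pos_part_def)
  show "(\<Sum>t\<in>F. coord x t) \<le> 1" if "F \<in> tree_chains" "finite F"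
    using assms that norm_le_iff[of 1 x] pos by (simp add: pos_part_def)
qed

lemma tree_unit_in_ball: "tree_unit t \<in> pos_part (cball 0 1)"
  by (rule pos_part_cballI) (auto simp: of_bool_def)

lemma prefixes_tree_chain: "set (prefixes t) \<in> tree_chains"
  using prefix_same_cases[of _ t]
  by (auto simp: tree_chains_def Complete_Partial_Order.chain_def)

text \<open>
  Approximate \<open>x\<close> by any finitely supported \<open>u\<close> and restrict \<open>x\<close> to the support of \<open>u\<close>. The restriction
  stays in the positive part of the ball, and it differs from \<open>x\<close> by no more than \<open>u\<close> in each coordinate.
\<close>

lemma finite_support_dense_pos_ball:
  assumes x: "x \<in> pos_part (cball 0 1)" and e: "e > 0"
  obtains y where "y \<in> pos_part (cball 0 1)" "finite {t. coord y t \<noteq> 0}" "norm (x - y) < e"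
proof -
  have "x \<in> closure {x. finite {t. coord x t \<noteq> 0}}"
    by (simp add: dense_finite_support)
  then obtain u where u: "finite {t. coord u t \<noteq> 0}" "norm (x - u) < e"
    using e unfolding closure_approachable by (auto simp: dist_norm norm_minus_commute)
  have fin: "finite {t. (if coord u t \<noteq> 0 then coord x t else 0) \<noteq> 0}"
    by (rule finite_subset[OF _ u(1)]) auto
  obtain y where y: "coord y = (\<lambda>t. if coord u t \<noteq> 0 then coord x t else 0)"
    using ex_finite_support[OF fin] by blast
  have "y \<in> pos_part (cball 0 1)"
  proof (rule pos_part_cballI)
    show "coord y t \<ge> 0" for t
      using pos_part_cballD(1)[OF x] by (simp add: y)
    fix F assume F: "F \<in> tree_chains" "finite F"
    have "(\<Sum>t\<in>F. coord y t) \<le> (\<Sum>t\<in>F. coord x t)"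
      by (rule sum_mono) (simp add: y pos_part_cballD(1)[OF x])
    then show "(\<Sum>t\<in>F. coord y t) \<le> 1"
      using pos_part_cballD(2)[OF x F] by simp
  qed
  moreover have "norm (x - y) \<le> norm (x - u)"
    unfolding norm_le_iff[OF norm_ge_zero]
  proof (intro ballI impI)
    fix F assume F: "F \<in> tree_chains" "finite F"
    have "(\<Sum>t\<in>F. \<bar>coord (x - y) t\<bar>) \<le> (\<Sum>t\<in>F. \<bar>coord (x - u) t\<bar>)"
      by (rule sum_mono) (simp add: y)
    then show "(\<Sum>t\<in>F. \<bar>coord (x - y) t\<bar>) \<le> norm (x - u)"
      using sum_le_norm[OF F, of "x - u"] by simp
  qed
  ultimately show ?thesis
    using that[of y] fin u(2) by (simp add: y)
qed

lemma finite_support_in_slice: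
  assumes "is_slice (pos_part (cball 0 1)) S"
  obtains y where "y \<in> S" "y \<in> pos_part (cball 0 1)" "finite {t. coord y t \<noteq> 0}"
proof -
  obtain f \<delta> where S: "S = slice (pos_part (cball 0 1)) f \<delta>"
    using assms unfolding is_slice_def by blast
  obtain x where x: "x \<in> S"
    using slice_nonempty[OF pos_part_cball(1,3) assms] by blast
  define r where "r = blinfun_apply f x - (Sup (blinfun_apply f ` pos_part (cball 0 1)) - \<delta>)"
  have xB: "x \<in> pos_part (cball 0 1)" and r: "r > 0"
    using x by (auto simp: S slice_def r_def)
  have pos: "norm f + 1 > 0" by (simp add: add_nonneg_pos)
  then obtain y where y: "y \<in> pos_part (cball 0 1)" "finite {t. coord y t \<noteq> 0}"
      "norm (x - y) < r / (norm f + 1)"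
    using finite_support_dense_pos_ball[OF xB, of "r / (norm f + 1)"] r by auto
  have "blinfun_apply f x - blinfun_apply f y \<le> norm f * norm (x - y)"
    using norm_blinfun[of f "x - y"] by (simp add: blinfun.diff_right)
  also have "\<dots> \<le> (norm f + 1) * norm (x - y)"
    by (simp add: mult_right_mono)
  also have "\<dots> < r"
    using y(3) pos by (simp add: field_simps)
  finally have "y \<in> S"
    using y(1) by (simp add: S slice_def r_def)
  then show ?thesis using that y by blast
qed

section \<open>SCD points of the positive part of the ball\<close>

text \<open>
  A chain meets an antichain in at most one node.
\<close>

lemma antichain_sum_in_ball:
  assumes "\<And>s t. s \<in> A \<Longrightarrow> t \<in> A \<Longrightarrow> prefix s t \<Longrightarrow> s = t"
  shows "(\<Sum>t\<in>A. tree_unit t) \<in> pos_part (cball 0 1)"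
proof (cases "finite A")
  case True
  have c: "coord (\<Sum>t\<in>A. tree_unit t) s = of_bool (s \<in> A)" for s
    using True by (simp add: coord_sum of_bool_def)
  show ?thesis
  proof (rule pos_part_cballI)
    fix F assume F: "F \<in> tree_chains" "finite F"
    have "card (F \<inter> A) \<le> 1"
      using card_le_Suc0_iff_eq[of "F \<inter> A"] F(2) tree_chainsD[OF F(1)] assms
      by (metis Int_iff One_nat_def finite_Int)
    then show "(\<Sum>s\<in>F. coord (\<Sum>t\<in>A. tree_unit t) s) \<le> 1"
      using F(2) by (simp add: c of_bool_def sum.If_cases)
  qed (simp add: c)
next
  \<comment> \<open>A sum over an infinite set is \<open>0\<close> by convention.\<close>
  case False
  then show ?thesis by (simp add: pos_part_def)
qed

text \<open>
  Otherwise there would be arbitrarily large finite antichains above \<open>t\<close> with the functional at most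
  \<open>- e\<close> at every unit vector. Their sums have norm at most one, so the functional would be unbounded.
\<close>

lemma ex_almost_nonneg_node:
  fixes f :: "tree_space \<Rightarrow>\<^sub>L real"
  assumes e: "e > 0"
  obtains s where "prefix t s" "length s > l" "blinfun_apply f (tree_unit s) > - e"
proof (rule ccontr)
  assume neg: "\<not> thesis"
  \<comment> \<open>The nodes branching off to the right from the leftmost path above \<open>t\<close> are pairwise incomparable.\<close>
  define a where "a i = t @ replicate (l + i) False @ [True]" for i
  define A where "A k = a ` {..<k}" for k
  have anti: "i = j" if "prefix (a i) (a j)" for i j
  proof -
    have "prefix (replicate i False @ [True]) (replicate j False @ [True])"
      using that by (simp add: a_def replicate_add)
    then obtain zs where zs: "replicate j False @ [True] = replicate i False @ True # zs"
      by (auto simp: prefix_def)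
    then have "(replicate j False @ [True]) ! i"
      by (simp add: nth_append)
    then have "\<not> i < j" by (auto simp: nth_append)
    moreover have "i \<le> j" using arg_cong[OF zs, of length] by simp
    ultimately show ?thesis by simp
  qed
  have bad: "blinfun_apply f (tree_unit (a i)) \<le> - e" for i
    using neg that[of "a i"] by (force simp: a_def)
  have "real k * e \<le> norm f" for k
  proof -
    have inj: "inj_on a {..<k}" using anti by (intro inj_onI) simp
    have "(\<Sum>s\<in>A k. tree_unit s) \<in> pos_part (cball 0 1)"
      by (rule antichain_sum_in_ball) (auto simp: A_def dest: anti)
    then have n: "norm (\<Sum>s\<in>A k. tree_unit s) \<le> 1"
      by (simp add: pos_part_def)
    have "blinfun_apply f (\<Sum>s\<in>A k. tree_unit s) = (\<Sum>i<k. blinfun_apply f (tree_unit (a i)))"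
      by (simp add: blinfun.sum_right A_def sum.reindex[OF inj])
    also have "\<dots> \<le> (\<Sum>i<k. - e)" by (intro sum_mono bad)
    finally have "real k * e \<le> \<bar>blinfun_apply f (\<Sum>s\<in>A k. tree_unit s)\<bar>"
      by simp
    also have "\<dots> \<le> norm f * norm (\<Sum>s\<in>A k. tree_unit s)"
      using norm_blinfun[of f] by simp
    also have "\<dots> \<le> norm f"
      using n by (simp add: mult_left_le)
    finally show ?thesis .
  qed
  moreover obtain k :: nat where "norm f < real k * e"
    using reals_Archimedean3[OF e] by blast
  ultimately show False by (meson not_less)
qed

text \<open>
  The missing mass of the path to \<open>t\<close> is put at \<open>t\<close>. As \<open>y\<close> vanishes at all strict successors of \<open>t\<close>, a
  chain through \<open>t\<close> sees nothing but part of this path, whose sum is now one; other chains see no change.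
  For the same reason the sum remains one along all longer paths, which allows one branch to serve
  for many such vectors.
\<close>

lemma fill_branch:
  assumes y: "y \<in> pos_part (cball 0 1)"
    and len: "\<And>s. coord y s \<noteq> 0 \<Longrightarrow> length s < length t"
  defines "y' \<equiv> y + (1 - (\<Sum>s\<in>set (prefixes t). coord y s)) *\<^sub>R tree_unit t"
  shows "y' \<in> pos_part (cball 0 1)"
    and "prefix t u \<Longrightarrow> (\<Sum>s\<in>set (prefixes u). coord y' s) = 1"
proof -
  define p where "p = (\<Sum>s\<in>set (prefixes t). coord y s)"
  have p: "p \<le> 1"
    unfolding p_def by (intro pos_part_cballD(2)[OF y] prefixes_tree_chain) simp
  have c: "coord y' s = coord y s + (if s = t then 1 - p else 0)" for s
    by (simp add: y'_def p_def)
  show "y' \<in> pos_part (cball 0 1)"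
  proof (rule pos_part_cballI)
    show "coord y' s \<ge> 0" for s
      using p pos_part_cballD(1)[OF y, of s] by (simp add: c)
    fix F assume F: "F \<in> tree_chains" "finite F"
    have sum: "(\<Sum>s\<in>F. coord y' s) = (\<Sum>s\<in>F. coord y s) + (if t \<in> F then 1 - p else 0)"
      using F(2) by (simp add: c sum.distrib)
    show "(\<Sum>s\<in>F. coord y' s) \<le> 1"
    proof (cases "t \<in> F")
      case True
      have "(\<Sum>s\<in>F. coord y s) = (\<Sum>s\<in>F \<inter> set (prefixes t). coord y s)"
      proof (rule sum.mono_neutral_right[OF F(2)])
        have "coord y s = 0" if "s \<in> F" "\<not> prefix s t" for s
          using tree_chainsD[OF F(1) \<open>t \<in> F\<close> that(1)] that(2) len[of s]
          by (meson leD prefix_length_le)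
        then show "\<forall>s\<in>F - F \<inter> set (prefixes t). coord y s = 0" by simp
      qed simp
      also have "\<dots> \<le> p"
        unfolding p_def by (rule sum_mono2) (auto simp: pos_part_cballD(1)[OF y])
      finally show ?thesis using True by (simp add: sum)
    next
      case False
      then show ?thesis using pos_part_cballD(2)[OF y F] by (simp add: sum)
    qed
  qed
  assume u: "prefix t u"
  have "(\<Sum>s\<in>set (prefixes u). coord y s) = p"
    unfolding p_def
  proof (rule sum.mono_neutral_right)
    show "set (prefixes t) \<subseteq> set (prefixes u)" using u by (auto simp: set_prefixes_eq)
    show "\<forall>s\<in>set (prefixes u) - set (prefixes t). coord y s = 0"
      using u len by (auto simp: set_prefixes_eq) (metis leD prefix_length_le prefix_same_cases)
  qed simp
  then show "(\<Sum>s\<in>set (prefixes u). coord y' s) = 1"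
    using u by (simp add: c sum.distrib)
qed

text \<open>
  The witnessing points are chosen in the slices first, and only then the nodes \<open>b n\<close> at which they
  are filled up. Each node extends the preceding one and lies beyond the support of the point that
  it belongs to. A convex combination involves finitely many points, so that its sum along the path to
  \<open>b n\<close> is one for all large \<open>n\<close>.
\<close>

lemma SCD_point_pos_ball_path_sums:
  assumes x: "SCD_point (pos_part (cball 0 1)) x" and e: "e > 0"
  shows "\<exists>u. prefix t u \<and> (\<Sum>s\<in>set (prefixes u). coord x s) > 1 - e"
proof -
  let ?B = "pos_part (cball 0 1) :: tree_space set"
  obtain S where S: "\<And>n. is_slice ?B (S n)"
    and hull: "\<And>y. (\<And>n :: nat. y n \<in> S n) \<Longrightarrow> x \<in> closure (convex hull (range y))"
    using x unfolding SCD_point_def by blast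
  have "\<exists>y \<in> ?B. y \<in> S n \<and> finite {s. coord y s \<noteq> 0}" for n
    using finite_support_in_slice[OF S[of n]] by blast
  then obtain y where y: "\<And>n. y n \<in> ?B" "\<And>n. y n \<in> S n" "\<And>n. finite {s. coord (y n) s \<noteq> 0}"
    by metis
  have "\<exists>l. \<forall>s. coord (y n) s \<noteq> 0 \<longrightarrow> length s \<le> l" for n
    using finite_maxlen[OF y(3)[of n]] by (auto intro: less_imp_le)
  then obtain l where l: "\<And>n s. coord (y n) s \<noteq> 0 \<Longrightarrow> length s \<le> l n"
    by metis
  define z where "z n u = y n + (1 - (\<Sum>s\<in>set (prefixes u). coord (y n) s)) *\<^sub>R tree_unit u"
    for n u
  have step: "\<exists>u. prefix v u \<and> length u > l n \<and> z n u \<in> S n" for n v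
  proof -
    obtain f \<delta> where f: "S n = slice ?B f \<delta>"
      using S[of n] unfolding is_slice_def by blast
    \<comment> \<open>\<open>r\<close> is the margin by which \<open>y n\<close> lies inside the slice; filling up may lower \<open>f\<close> by less than \<open>r\<close>.\<close>
    define r where "r = blinfun_apply f (y n) - (Sup (blinfun_apply f ` ?B) - \<delta>)"
    have r: "r > 0" using y(2)[of n] by (simp add: f slice_def r_def)
    then obtain u where u: "prefix v u" "length u > l n" "blinfun_apply f (tree_unit u) > - r"
      using ex_almost_nonneg_node by blast
    define c where "c = 1 - (\<Sum>s\<in>set (prefixes u). coord (y n) s)"
    have "0 \<le> c" "c \<le> 1"
      using pos_part_cballD[OF y(1)[of n]] prefixes_tree_chain[of u]
      by (auto simp: c_def intro!: sum_nonneg)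
    have "c * blinfun_apply f (tree_unit u) > - r"
    proof (cases "blinfun_apply f (tree_unit u) \<ge> 0")
      case True
      then have "c * blinfun_apply f (tree_unit u) \<ge> 0" using \<open>0 \<le> c\<close> by simp
      then show ?thesis using r by linarith
    next
      case False
      then have "1 * blinfun_apply f (tree_unit u) \<le> c * blinfun_apply f (tree_unit u)"
        using \<open>c \<le> 1\<close> by (intro mult_right_mono_neg) auto
      then show ?thesis using u(3) by linarith
    qed
    then have "blinfun_apply f (z n u) > Sup (blinfun_apply f ` ?B) - \<delta>"
      by (simp add: z_def blinfun.add_right blinfun.scaleR_right r_def flip: c_def)
    moreover have "z n u \<in> ?B"
      unfolding z_def using u(2) l[of n] by (intro fill_branch(1) y(1)) force
    ultimately have "z n u \<in> S n" by (simp add: f slice_def)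
    then show ?thesis using u by blast
  qed
  have "\<exists>b. \<forall>n. (prefix t (b n) \<and> length (b n) > l n \<and> z n (b n) \<in> S n) \<and> prefix (b n) (b (Suc n))"
  proof (rule dependent_nat_choice)
    show "\<exists>u. prefix t u \<and> length u > l 0 \<and> z 0 u \<in> S 0" by (rule step)
    fix v n assume "prefix t v \<and> length v > l n \<and> z n v \<in> S n"
    then show "\<exists>u. (prefix t u \<and> length u > l (Suc n) \<and> z (Suc n) u \<in> S (Suc n)) \<and> prefix v u"
      using step[of v "Suc n"] by (meson prefix_order.trans)
  qed
  then obtain b where b: "\<And>n. prefix t (b n)" "\<And>n. length (b n) > l n" "\<And>n. z n (b n) \<in> S n"
      "\<And>n. prefix (b n) (b (Suc n))"
    by blast
  have mono: "prefix (b m) (b n)" if "m \<le> n" for m n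
    using that by (induction rule: dec_induct) (auto intro: b(4) prefix_order.trans)
  \<comment> \<open>Phrased with ``for all large \<open>n\<close>'', the property is convex, so it passes to the convex hull.\<close>
  define W where "W = {w. \<exists>m. \<forall>n\<ge>m. (\<Sum>s\<in>set (prefixes (b n)). coord w s) = 1}"
  have "z n (b n) \<in> W" for n
  proof -
    have "length s < length (b n)" if "coord (y n) s \<noteq> 0" for s
      using l[OF that] b(2)[of n] by simp
    then have "(\<Sum>s\<in>set (prefixes (b k)). coord (z n (b n)) s) = 1" if "k \<ge> n" for k
      unfolding z_def using mono[OF that] by (intro fill_branch(2) y(1))
    then show ?thesis unfolding W_def by blast
  qed
  moreover have "convex W"
    unfolding convex_def
  proof (intro ballI allI impI)
    fix w w' and c d :: real assume "w \<in> W" "w' \<in> W" and cd: "c + d = 1"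
    then obtain m m' where m: "\<And>n. n \<ge> m \<Longrightarrow> (\<Sum>s\<in>set (prefixes (b n)). coord w s) = 1"
      "\<And>n. n \<ge> m' \<Longrightarrow> (\<Sum>s\<in>set (prefixes (b n)). coord w' s) = 1"
      unfolding W_def by blast
    have "(\<Sum>s\<in>set (prefixes (b n)). coord (c *\<^sub>R w + d *\<^sub>R w') s) = 1" if "n \<ge> max m m'" for n
      using m[of n] that cd by (simp add: sum.distrib flip: sum_distrib_left)
    then show "c *\<^sub>R w + d *\<^sub>R w' \<in> W" unfolding W_def by blast
  qed
  ultimately have sub: "convex hull (range (\<lambda>n. z n (b n))) \<subseteq> W"
    by (intro hull_minimal) auto
  obtain w where w: "w \<in> convex hull (range (\<lambda>n. z n (b n)))" "dist w x < e"
    using hull[of "\<lambda>n. z n (b n)"] b(3) e unfolding closure_approachable by blast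
  then obtain n where n: "(\<Sum>s\<in>set (prefixes (b n)). coord w s) = 1"
    using sub unfolding W_def by blast
  have "(\<Sum>s\<in>set (prefixes (b n)). coord w s) - (\<Sum>s\<in>set (prefixes (b n)). coord x s)
      \<le> (\<Sum>s\<in>set (prefixes (b n)). \<bar>coord (w - x) s\<bar>)"
    unfolding sum_subtractf[symmetric] by (rule sum_mono) simp
  also have "\<dots> \<le> norm (w - x)"
    by (rule sum_le_norm) (auto simp: prefixes_tree_chain)
  finally show ?thesis
    using n w(2) b(1)[of n] by (auto simp: dist_norm intro!: exI[of _ "b n"])
qed

section \<open>From the symmetric hull to the positive part\<close>

lemma parts_subset_tree_C: "pos_part (cball 0 1) \<union> neg_part (cball 0 1) \<subseteq> tree_C"
  unfolding tree_C_def by (rule order_trans[OF hull_subset closure_subset])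

text \<open>
  If the slice misses \<open>B\<^sup>-\<close>, its functional stays away from the supremum over \<open>C\<close> there. The supremum
  over \<open>C\<close> is then the one over \<open>B\<^sup>+\<close>, and the slice of \<open>B\<^sup>+\<close> with the same data lies in the given slice.
\<close>

lemma slice_tree_C_cases:
  assumes "is_slice tree_C S"
  obtains (pos) f \<delta> where "\<delta> > 0" "slice (pos_part (cball 0 1)) f \<delta> \<subseteq> S"
  | (neg) v where "v \<in> S" "v \<in> neg_part (cball 0 1)"
proof -
  let ?P = "pos_part (cball 0 1) :: tree_space set" and ?N = "neg_part (cball 0 1) :: tree_space set"
  obtain f \<delta> where f: "\<delta> > 0" "S = slice tree_C f \<delta>"
    using assms unfolding is_slice_def by blast
  define a where "a = Sup (blinfun_apply f ` ?P)"
  have C: "?P \<subseteq> tree_C" "?N \<subseteq> tree_C"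
    using parts_subset_tree_C by auto
  have bdd: "bdd_above (blinfun_apply f ` ?P)"
    by (intro bounded_imp_bdd_above bounded_linear_image[OF pos_part_cball(1)]
        blinfun.bounded_linear_right)
  show ?thesis
  proof (cases "\<exists>v\<in>?N. v \<in> S")
    case True
    then show ?thesis using neg by blast
  next
    case False
    define m where "m = Sup (blinfun_apply f ` tree_C)"
    have N: "blinfun_apply f v \<le> m - \<delta>" if "v \<in> ?N" for v
      using False that C(2) by (force simp: f slice_def m_def)
    define c where "c = max a (m - \<delta>)"
    have "tree_C \<subseteq> {v. blinfun_apply f v \<le> c}"
      unfolding tree_C_def
    proof (intro closure_minimal hull_minimal)
      show "?P \<union> ?N \<subseteq> {v. blinfun_apply f v \<le> c}"
        using N cSup_upper[OF imageI bdd, of _] by (force simp: c_def a_def)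
      show "convex {v. blinfun_apply f v \<le> c}"
        using convex_linear_vimage[OF blinfun.bounded_linear_right[THEN bounded_linear.linear], 
            of "{..c}" f] by (simp add: vimage_def)
      show "closed {v. blinfun_apply f v \<le> c}"
        by (intro closed_Collect_le continuous_intros)
    qed
    then have "m \<le> c"
      unfolding m_def using tree_C_props(3) by (intro cSUP_least) auto
    then have "m \<le> a" using f(1) by (simp add: c_def)
    then have "slice ?P f \<delta> \<subseteq> S"
      using C(1) by (auto simp: f slice_def a_def m_def)
    then show ?thesis using pos f(1) by blast
  qed
qed

text \<open>
  Let \<open>w\<close> be a convex combination in which the points of \<open>N\<close> have total weight \<open>c\<close>. Its sums over chains
  are at most \<open>1 - c\<close>, and shifting the weight \<open>c\<close> to a point of \<open>P\<close> moves it by at most \<open>2 * c\<close>. If \<open>w\<close>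
  is close to \<open>x\<close>, the first property forces \<open>c\<close> to be small, and then \<open>x\<close> is close to the shifted
  combination, which lies in the convex hull of \<open>P\<close>.
\<close>

lemma closure_hull_drop_neg:
  assumes x: "x \<in> pos_part (sphere 0 1)" and P: "P \<noteq> {}" "P \<subseteq> pos_part (cball 0 1)"
    and N: "N \<subseteq> neg_part (cball 0 1)" and cl: "x \<in> closure (convex hull (P \<union> N))"
  shows "x \<in> closure (convex hull P)"
proof -
  \<comment> \<open>The two properties of \<open>w\<close> and \<open>c\<close> just described define a convex set \<open>K\<close>, which contains \<open>P\<close> with
     \<open>c = 0\<close> and \<open>N\<close> with \<open>c = 1\<close>. This avoids splitting \<open>w\<close> into normalised parts, where a part of
     weight zero would need separate treatment.\<close>
  define sums_le where
    "sums_le w c \<longleftrightarrow> (\<forall>F\<in>tree_chains. finite F \<longrightarrow> (\<Sum>t\<in>F. coord w t) \<le> c)" for w c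
  have sums_leD: "(\<Sum>t\<in>F. coord w t) \<le> c"
    if "sums_le w c" "F \<in> tree_chains" "finite F" for w c F
    using that unfolding sums_le_def by blast
  define K where "K = {w. \<exists>y c. y \<in> convex hull P \<and> norm (w - y) \<le> 2 * c \<and> sums_le w (1 - c)}"
  have "w \<in> K" if "w \<in> P" for w
  proof -
    have "w \<in> convex hull P" using that by (rule hull_inc)
    moreover have "norm (w - w) \<le> 2 * 0" by simp
    moreover have "sums_le w (1 - 0)"
      using pos_part_cballD(2)[of w] that P(2) by (auto simp: sums_le_def)
    ultimately show ?thesis unfolding K_def by blast
  qed
  moreover have "w \<in> K" if "w \<in> N" for w
  proof -
    obtain p where p: "p \<in> P" using P(1) by blast
    have "norm (w - p) \<le> 2 * 1"
      using norm_triangle_ineq4[of w p] that p P(2) N by (force simp: pos_part_def neg_part_def)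
    moreover have "sums_le w (1 - 1)"
      using that N by (force simp: neg_part_def sums_le_def intro: sum_nonpos)
    moreover have "p \<in> convex hull P" using p by (rule hull_inc)
    ultimately show ?thesis unfolding K_def by blast
  qed
  moreover have "convex K"
    unfolding convex_def
  proof (intro ballI allI impI)
    fix w w' and a b :: real
    assume "w \<in> K" "w' \<in> K" and ab: "0 \<le> a" "0 \<le> b" "a + b = 1"
    then obtain y c y' c' where *: "y \<in> convex hull P" "norm (w - y) \<le> 2 * c"
        "sums_le w (1 - c)"
        "y' \<in> convex hull P" "norm (w' - y') \<le> 2 * c'"
        "sums_le w' (1 - c')"
      unfolding K_def by blast
    have "norm ((a *\<^sub>R w + b *\<^sub>R w') - (a *\<^sub>R y + b *\<^sub>R y')) = norm (a *\<^sub>R (w - y) + b *\<^sub>R (w' - y'))"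
      by (simp add: algebra_simps)
    also have "\<dots> \<le> a * norm (w - y) + b * norm (w' - y')"
      using norm_triangle_ineq[of "a *\<^sub>R (w - y)" "b *\<^sub>R (w' - y')"] ab by simp
    also have "\<dots> \<le> a * (2 * c) + b * (2 * c')"
      using * ab by (intro add_mono mult_left_mono) auto
    finally have "norm ((a *\<^sub>R w + b *\<^sub>R w') - (a *\<^sub>R y + b *\<^sub>R y')) \<le> 2 * (a * c + b * c')"
      by (simp add: algebra_simps)
    moreover have "sums_le (a *\<^sub>R w + b *\<^sub>R w') (1 - (a * c + b * c'))"
      unfolding sums_le_def
    proof (intro ballI impI)
      fix F assume F: "F \<in> tree_chains" "finite F"
      have "(\<Sum>t\<in>F. coord (a *\<^sub>R w + b *\<^sub>R w') t)
          = a * (\<Sum>t\<in>F. coord w t) + b * (\<Sum>t\<in>F. coord w' t)"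
        by (simp add: sum.distrib sum_distrib_left)
      also have "\<dots> \<le> a * (1 - c) + b * (1 - c')"
        using sums_leD[OF *(3) F] sums_leD[OF *(6) F] ab by (intro add_mono mult_left_mono)
      also have "\<dots> = (a + b) - (a * c + b * c')"
        by (simp add: algebra_simps)
      finally show "(\<Sum>t\<in>F. coord (a *\<^sub>R w + b *\<^sub>R w') t) \<le> 1 - (a * c + b * c')"
        by (simp only: ab(3))
    qed
    moreover have "a *\<^sub>R y + b *\<^sub>R y' \<in> convex hull P"
      using *(1,4) ab by (intro convexD[OF convex_convex_hull])
    ultimately show "a *\<^sub>R w + b *\<^sub>R w' \<in> K"
      unfolding K_def by blast
  qed
  ultimately have sub: "convex hull (P \<union> N) \<subseteq> K"
    by (intro hull_minimal) auto
  show ?thesis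
    unfolding closure_approachable
  proof (intro allI impI)
    fix e :: real assume "e > 0"
    \<comment> \<open>The distance to \<open>y\<close> is below \<open>d + 2 * c\<close> with \<open>c < 2 * d\<close>, hence the factor \<open>5\<close>.\<close>
    define d where "d = min (e / 5) 1"
    have d: "d > 0" "d \<le> 1" "5 * d \<le> e" using \<open>e > 0\<close> by (auto simp: d_def)
    obtain w where w: "w \<in> convex hull (P \<union> N)" "dist w x < d"
      using cl d(1) unfolding closure_approachable by blast
    obtain y c where y: "y \<in> convex hull P" "norm (w - y) \<le> 2 * c"
        "sums_le w (1 - c)"
      using w(1) sub unfolding K_def by blast
    have "\<not> norm x \<le> 1 - d" using x d(1) by (simp add: pos_part_def)
    then obtain F where F: "F \<in> tree_chains" "finite F" "(\<Sum>t\<in>F. \<bar>coord x t\<bar>) > 1 - d"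
      using norm_le_iff[of "1 - d" x] d(2) by (auto simp: not_le)
    have "(\<Sum>t\<in>F. \<bar>coord x t\<bar>) - (\<Sum>t\<in>F. coord w t) \<le> (\<Sum>t\<in>F. \<bar>coord (w - x) t\<bar>)"
      unfolding sum_subtractf[symmetric] using x by (intro sum_mono) (auto simp: pos_part_def)
    also have "\<dots> \<le> norm (w - x)" by (rule sum_le_norm[OF F(1,2)])
    finally have "c < 2 * d"
      using F(3) sums_leD[OF y(3) F(1,2)] w(2) by (simp add: dist_norm)
    then have "dist y x < e"
      using dist_triangle[of y x w] y(2) w(2) d(3) by (simp add: dist_norm norm_minus_commute)
    then show "\<exists>y\<in>convex hull P. dist y x < e" using y(1) by blast
  qed
qed

lemma SCD_point_tree_C_imp_pos_ball:
  assumes x: "x \<in> pos_part (sphere 0 1)" and scd: "SCD_point tree_C x"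
  shows "SCD_point (pos_part (cball 0 1)) x"
proof -
  let ?P = "pos_part (cball 0 1) :: tree_space set" and ?N = "neg_part (cball 0 1) :: tree_space set"
  obtain S where S: "\<And>n. is_slice tree_C (S n)"
    and hull: "\<And>y. (\<And>n :: nat. y n \<in> S n) \<Longrightarrow> x \<in> closure (convex hull (range y))"
    using scd unfolding SCD_point_def by blast
  have "\<exists>T. is_slice ?P T \<and> (T \<subseteq> S n \<or> (\<exists>v\<in>?N. v \<in> S n))" for n
  proof (cases rule: slice_tree_C_cases[OF S[of n]])
    case (1 f \<delta>)
    then show ?thesis unfolding is_slice_def by blast
  next
    case (2 v)
    \<comment> \<open>The negative point \<open>v\<close> will be selected in \<open>S n\<close>, so any slice of \<open>?P\<close> will do.\<close>
    have "is_slice ?P (slice ?P 0 1)" unfolding is_slice_def using zero_less_one by blast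
    then show ?thesis using 2 by blast
  qed
  then obtain T where T: "\<And>n. is_slice ?P (T n)" "\<And>n. T n \<subseteq> S n \<or> (\<exists>v\<in>?N. v \<in> S n)"
    by metis
  have "x \<in> closure (convex hull (range y))" if y: "\<forall>n. y n \<in> T n" for y
  proof -
    have "\<exists>w. w \<in> S n \<and> (w = y n \<or> w \<in> ?N)" for n
      using T(2)[of n] y by blast
    then obtain w where w: "\<And>n. w n \<in> S n" "\<And>n. w n = y n \<or> w n \<in> ?N"
      by metis
    have "range w \<subseteq> range y \<union> (range w \<inter> ?N)" using w(2) by auto
    then have "closure (convex hull (range w)) \<subseteq> closure (convex hull (range y \<union> (range w \<inter> ?N)))"
      by (intro closure_mono hull_mono)
    then have "x \<in> closure (convex hull (range y \<union> (range w \<inter> ?N)))"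
      using hull[OF w(1)] by blast
    moreover have "range y \<subseteq> ?P"
      using y T(1) unfolding is_slice_def slice_def by blast
    ultimately show ?thesis
      using closure_hull_drop_neg[OF x, of "range y" "range w \<inter> ?N"] by blast
  qed
  moreover have "x \<in> ?P" using x by (simp add: pos_part_def)
  ultimately show ?thesis unfolding SCD_point_def using T(1) by blast
qed

theorem proposition3p10:
  shows "(\<forall>x \<in> pos_part (sphere 0 1). SCD_point tree_C x \<longrightarrow> SCD_point (pos_part (cball 0 1)) x)
    \<and> \<not> SCD_set tree_C"
proof (intro conjI ballI impI notI)
  show "SCD_point (pos_part (cball 0 1)) x"
    if "x \<in> pos_part (sphere 0 1)" "SCD_point tree_C x" for x
    using SCD_point_tree_C_imp_pos_ball that .
next
  assume scd: "SCD_set tree_C"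
  let ?x = "tree_unit [False]"
  have B: "?x \<in> pos_part (cball 0 1)" by (rule tree_unit_in_ball)
  then have "?x \<in> tree_C"
    using parts_subset_tree_C by blast
  then have "SCD_point tree_C ?x"
    using scd unfolding SCD_set_def SCD_point_def by blast
  moreover have "?x \<in> pos_part (sphere 0 1)"
    using B abs_coord_le_norm[of ?x "[False]"] by (simp add: pos_part_def)
  ultimately have "SCD_point (pos_part (cball 0 1)) ?x"
    by (rule SCD_point_tree_C_imp_pos_ball[rotated])
  then obtain u where u: "prefix [True] u" "(\<Sum>s\<in>set (prefixes u). coord ?x s) > 1 - 1"
    using SCD_point_pos_ball_path_sums[of ?x 1 "[True]"] by auto
  have "\<not> prefix [False] u" using u(1) by (auto simp: prefix_def)
  then have "coord ?x s = 0" if "s \<in> set (prefixes u)" for s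
    using that by auto
  then show False using u(2) by simp
qed

end
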